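(* There is no (finite) seed $n_0\in\mathbb{N}$ for which the compact Collatz iteration $$n_{i+1}=\begin{cases} n_i/2, & 2\mid n_i,\\ \dfrac{3n_i+1}{2}, & 2\nmid n_i,\end{cases}$$ repeats the odd step indefinitely; that is, there is no $n_0\in\mathbb{N}$ such that $n_i$ is odd for every $i\ge 0$.
   Context: $\mathbb{N}=\{0,1,2,\dots\}$. The odd step is the second branch $n_i\mapsto(3n_i+1)/2$, applied when $n_i$ is odd. *)

theory Defs
  imports Main
begin

text \<open>The division in the odd branch is exact, since \<open>3 * n + 1\<close> is even for odd \<open>n\<close>.\<close>

definition collatz_step :: "nat \<Rightarrow> nat" where
  "collatz_step n = (if 2 dvd n then n div 2 else (3 * n + 1) div 2)"

definition collatz_seq :: "nat \<Rightarrow> nat \<Rightarrow> nat" where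
  "collatz_seq n\<^sub>0 i = (collatz_step ^^ i) n\<^sub>0"

end

theory Submission
  imports Defs
begin

text \<open>Shifting by one turns the odd step into multiplication by \<open>3/2\<close>, because
  \<open>(3 * n + 1) / 2 + 1 = 3 * (n + 1) / 2\<close>. So \<open>i\<close> consecutive odd steps multiply \<open>n + 1\<close> by
  \<open>(3/2) ^ i\<close>, which stays integral only if \<open>2 ^ i\<close> divides \<open>n + 1\<close>. A seed whose orbit is odd
  forever would make the positive number \<open>n + 1\<close> divisible by every power of two
  (2-adically, the only such seed is \<open>-1\<close>).\<close>

lemma collatz_step_odd_shift:
  assumes "odd n"
  shows "2 * (collatz_step n + 1) = 3 * (n + 1)"
  using assms unfolding collatz_step_def by presburger

lemma collatz_seq_odd_closed_form:
  assumes "\<forall>j<i. odd (collatz_seq n j)"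
  shows "2 ^ i * (collatz_seq n i + 1) = 3 ^ i * (n + 1)"
  using assms
proof (induction i)
  case 0
  show ?case by (simp add: collatz_seq_def)
next
  case (Suc i)
  have "2 ^ Suc i * (collatz_seq n (Suc i) + 1)
      = 2 ^ i * (2 * (collatz_step (collatz_seq n i) + 1))"
    by (simp add: collatz_seq_def)
  also have "\<dots> = 2 ^ i * (3 * (collatz_seq n i + 1))"
    using Suc.prems by (subst collatz_step_odd_shift) auto
  also have "\<dots> = 3 * (2 ^ i * (collatz_seq n i + 1))"
    by (rule mult.left_commute)
  also have "\<dots> = 3 ^ Suc i * (n + 1)"
    using Suc by simp
  finally show ?case .
qed

theorem theorem7p1:
  shows "\<not> (\<exists>n\<^sub>0 :: nat. \<forall>i :: nat. odd (collatz_seq n\<^sub>0 i))"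
proof
  assume "\<exists>n\<^sub>0 :: nat. \<forall>i :: nat. odd (collatz_seq n\<^sub>0 i)"
  then obtain n where odd: "\<forall>i. odd (collatz_seq n i)" ..
  \<comment> \<open>The exponent \<open>n + 1\<close> is large enough for a contradiction, since \<open>k < 2 ^ k\<close>.\<close>
  define k where "k = n + 1"
  have "2 ^ k * (collatz_seq n k + 1) = 3 ^ k * k"
    using collatz_seq_odd_closed_form[of k n] odd by (simp add: k_def)
  then have "2 ^ k dvd 3 ^ k * k"
    by (metis dvd_triv_left)
  moreover have "coprime (2 ^ k) (3 ^ k :: nat)"
    by simp
  ultimately have "2 ^ k dvd k"
    by (simp add: coprime_dvd_mult_right_iff)
  then have "2 ^ k \<le> k"
    by (rule dvd_imp_le) (simp add: k_def)
  then show False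
    using less_exp[of k] by simp
qed

end
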